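(* Let $T_s>0$ be the step period, $v^d$ the desired walking velocity, $t_k=(k-0.5)T_s$ for $k\in\mathbb{N}$ the touchdown times, $\mathbf{A}_\lambda=\begin{bmatrix}0&1\\\lambda^2&0\end{bmatrix}$ with $\lambda=\sqrt{g/z_{sc}^d}$, and $\mathbf{B}_1=[1,0]^T$. Let the desired state $\mathbf{x}^d(t)\in\mathbb{R}^2$ be the solution of $$\dot{\mathbf{x}}^d(t)=\mathbf{A}_\lambda\mathbf{x}^d(t)\ \text{ if } t\ne t_k^-,\qquad \mathbf{x}^d(t_k^+)=\mathbf{x}^d(t_k^-)-\mathbf{B}_1T_sv^d\ \text{ if } t=t_k^-,\qquad \mathbf{x}^d(0)=\Big[0,\tfrac{v^dT_s\lambda}{2\sinh(0.5\lambda T_s)}\Big]^T,$$ and let the commanded state $\mathbf{x}^c(t)\in\mathbb{R}^2$ be the solution of $$\dot{\mathbf{x}}^c(t)=\mathbf{A}_\lambda\mathbf{x}^c(t)\ \text{ if } t\ne t_k^-,\qquad \mathbf{x}^c(t_k^+)=\mathbf{x}^c(t_k^-)-\mathbf{B}_1u(t_k^-)\ \text{ if } t=t_k^-,\qquad \mathbf{x}^c(0)=\mathbf{x}(0),$$ where $\mathbf{x}(0)=[0,0]^T$ is the robot's initial state. Let $\mathbf{e}^c(t)=\mathbf{x}^d(t)-\mathbf{x}^c(t)$. Then the step lengths chosen according to $$u(t_{k+1}^-)=T_sv^d-\mathbf{K}(\mathbf{A}_s-\mathbf{I})\mathbf{e}^c(t_k^+),$$ with $\mathbf{K}$ the LQR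 gain defined in the context, drive $\mathbf{e}^c(t)\to0$ and $\mathbf{x}^c(t)\to\mathbf{x}^d(t)$ as $t\to\infty$.
   Context: $t_k^-$ and $t_k^+$ denote the instants immediately before and after the touchdown time $t_k$. $g$ is the magnitude of the gravitational acceleration and $z_{sc}^d>0$ is the desired constant height of the center of mass above the support point. $\mathbf{I}$ is the $2\times2$ identity, $\mathbf{A}_s=\exp(\mathbf{A}_\lambda T_s)$, $\mathbf{B}_s=(\mathbf{A}_s-\mathbf{I})\mathbf{B}_1$, and $$\mathbf{K}=(\mathbf{R}+\mathbf{B}_s^T\mathbf{P}_s\mathbf{B}_s)^{-1}\mathbf{B}_s^T\mathbf{P}_s\mathbf{A}_s,$$ where $\mathbf{P}_s$ is the solution to the discrete-time algebraic Riccati equation $$\mathbf{P}_s=\mathbf{A}_s^T\mathbf{P}_s\mathbf{A}_s+\mathbf{Q}-(\mathbf{A}_s^T\mathbf{P}_s\mathbf{B}_s)(\mathbf{R}+\mathbf{B}_s^T\mathbf{P}_s\mathbf{B}_s)^{-1}(\mathbf{B}_s^T\mathbf{P}_s\mathbf{A}_s),$$ and $\mathbf{R}>0$ and $\mathbf{Q}\ge0$ are the LQR parameters, chosen for good performance.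
   Formalization: "The solution" P_s of the Riccati equation is taken as its greatest positive semidefinite solution; for merely Q≥0 there may be several (for Q=0, P_s=0 gives K=0 and the error diverges), and the greatest is the stabilizing one. *)

theory Defs
  imports "HOL-Analysis.Analysis"
begin

subsection \<open>Matrix exponential\<close>

text \<open>The type-class operations \<open>*\<close>, \<open>^\<close> on \<open>real^'n^'n\<close> are componentwise, so matrix
  powers are iterates of \<open>**\<close>, and the library's \<open>exp\<close> does not apply.\<close>

definition mat_pow :: "real^'n^'n \<Rightarrow> nat \<Rightarrow> real^'n^'n" where
  "mat_pow M n = (((**) M) ^^ n) (mat 1)"

definition mat_exp :: "real^'n^'n \<Rightarrow> real^'n^'n" where
  "mat_exp M = (\<Sum>n. mat_pow M n /\<^sub>R fact n)"

subsection \<open>Discrete-time linear quadratic regulator\<close>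

definition pos_semidef :: "real^'n^'n \<Rightarrow> bool" where
  "pos_semidef M \<longleftrightarrow> transpose M = M \<and> (\<forall>x. x \<bullet> (M *v x) \<ge> 0)"

definition pos_def :: "real^'n^'n \<Rightarrow> bool" where
  "pos_def M \<longleftrightarrow> transpose M = M \<and> (\<forall>x. x \<noteq> 0 \<longrightarrow> x \<bullet> (M *v x) > 0)"

definition satisfies_dare ::
  "real^'n^'n \<Rightarrow> real^'m^'n \<Rightarrow> real^'n^'n \<Rightarrow> real^'m^'m \<Rightarrow> real^'n^'n \<Rightarrow> bool" where
  "satisfies_dare A B Q R P \<longleftrightarrow>
     P = transpose A ** P ** A + Q
         - (transpose A ** P ** B) ** matrix_inv (R + transpose B ** P ** B)
             ** (transpose B ** P ** A)"

text \<open>When \<open>Q\<close> is only positive semidefinite, the equation may have several positive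
  semidefinite solutions: for \<open>Q = 0\<close> one of them is \<open>P = 0\<close>, whose gain is zero and does not
  stabilise an unstable plant.  ``The'' solution is, as usual, the greatest one in the Loewner
  order (the maximal solution); it is unique, and it is the only positive semidefinite solution whenever there is
  only one (see the two lemmas below).\<close>

definition dare_solution ::
  "real^'n^'n \<Rightarrow> real^'m^'n \<Rightarrow> real^'n^'n \<Rightarrow> real^'m^'m \<Rightarrow> real^'n^'n \<Rightarrow> bool" where
  "dare_solution A B Q R P \<longleftrightarrow>
     pos_semidef P \<and> satisfies_dare A B Q R P \<and>
     (\<forall>P'. pos_semidef P' \<and> satisfies_dare A B Q R P' \<longrightarrow> pos_semidef (P - P'))"

definition lqr_gain ::
  "real^'n^'n \<Rightarrow> real^'m^'n \<Rightarrow> real^'m^'m \<Rightarrow> real^'n^'n \<Rightarrow> real^'n^'m" where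
  "lqr_gain A B R P = matrix_inv (R + transpose B ** P ** B) ** transpose B ** P ** A"

lemma dare_solution_if_unique:
  assumes "pos_semidef P" "satisfies_dare A B Q R P"
    and "\<And>P'. pos_semidef P' \<Longrightarrow> satisfies_dare A B Q R P' \<Longrightarrow> P' = P"
  shows "dare_solution A B Q R P"
proof -
  have "pos_semidef (P - P)"
    by (simp add: pos_semidef_def transpose_def vec_eq_iff)
  then show ?thesis
    unfolding dare_solution_def using assms by blast
qed

lemma dare_solution_unique:
  assumes "dare_solution A B Q R P" "dare_solution A B Q R P'"
  shows "P = P'"
proof -
  define D where "D = P - P'"
  have D: "pos_semidef D" and D': "pos_semidef (P' - P)"
    using assms unfolding dare_solution_def D_def by blast+
  have mD: "P' - P = - D" by (simp add: D_def)
  have neg: "(- D) *v x = - (D *v x)" for x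
    using matrix_vector_mult_diff_rdistrib[of 0 D x] by simp
  have q: "x \<bullet> (D *v x) = 0" for x
    using D D' unfolding mD pos_semidef_def neg inner_minus_right
    by (metis neg_0_le_iff_le order_antisym)
  have s: "x \<bullet> (D *v y) = y \<bullet> (D *v x)" for x y
    using D unfolding pos_semidef_def by (metis dot_lmul_matrix inner_commute transpose_matrix_vector)
  have "x \<bullet> (D *v y) = 0" for x y
    using q[of "x + y"] q[of x] q[of y] s[of x y]
    by (simp add: matrix_vector_right_distrib inner_add_left inner_add_right)
  then have "D *v y = 0" for y
    using inner_eq_zero_iff by blast
  then have "D = 0"
    by (simp add: matrix_eq)
  then show ?thesis by (simp add: D_def)
qed

subsection \<open>Linear flow with state jumps\<close>

text \<open>\<open>x\<close> lives on \<open>[0, \<infinity>)\<close>: it follows \<open>x' = A x\<close> between the jump times \<open>\<tau> 1, \<tau> 2, \<dots>\<close>,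
  and at \<open>\<tau> k\<close> its left limit \<open>x(\<tau>\<^sub>k\<^sup>-)\<close> is reset to the right limit
  \<open>x(\<tau>\<^sub>k\<^sup>+) = x(\<tau>\<^sub>k\<^sup>-) - s\<^sub>k b\<close>.  The value at the instant \<open>\<tau> k\<close> itself is the post-jump
  one, so that differences of two solutions are also well defined there.\<close>

definition jump_flow_solution ::
  "real^'n^'n \<Rightarrow> real^'n \<Rightarrow> (nat \<Rightarrow> real) \<Rightarrow> (nat \<Rightarrow> real) \<Rightarrow> real^'n \<Rightarrow> (real \<Rightarrow> real^'n) \<Rightarrow> bool"
  where
  "jump_flow_solution A b \<tau> s x0 x \<longleftrightarrow>
     x 0 = x0 \<and>
     (\<forall>t\<ge>0. (\<forall>k\<ge>1. t \<noteq> \<tau> k) \<longrightarrow>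
        (x has_vector_derivative A *v x t) (at t within {0..})) \<and>
     (\<forall>k\<ge>1. \<exists>xminus xplus.
        (x \<longlongrightarrow> xminus) (at_left (\<tau> k)) \<and>
        (x \<longlongrightarrow> xplus) (at_right (\<tau> k)) \<and>
        xplus = xminus - s k *\<^sub>R b \<and>
        x (\<tau> k) = xplus)"

subsection \<open>The walking model\<close>

definition A_lam :: "real \<Rightarrow> real^2^2" where
  "A_lam lam = vector [vector [0, 1], vector [lam\<^sup>2, 0]]"

definition B1 :: "real^2" where
  "B1 = vector [1, 0]"

definition touchdown :: "real \<Rightarrow> nat \<Rightarrow> real" where
  "touchdown Ts k = (real k - 1/2) * Ts"

definition A_step :: "real \<Rightarrow> real \<Rightarrow> real^2^2" where
  "A_step lam Ts = mat_exp (Ts *\<^sub>R A_lam lam)"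

definition B_step :: "real \<Rightarrow> real \<Rightarrow> real^1^2" where
  "B_step lam Ts = columnvector ((A_step lam Ts - mat 1) *v B1)"

end

theory Submission
  imports Defs
begin

text \<open>With \<open>e\<^sub>k = e\<^sup>c(t\<^sub>k\<^sup>+)\<close>, the vectors \<open>w\<^sub>k = (A\<^sub>s - I) e\<^sub>k\<close> follow the LQR closed loop
  \<open>w\<^sub>k\<^sub>+\<^sub>1 = (A\<^sub>s - B\<^sub>s K) w\<^sub>k\<close>, along which \<open>w\<^sup>T P w\<close> decreases by at least \<open>R (K w)\<^sup>2\<close>; hence
  \<open>K w\<^sub>k \<longrightarrow> 0\<close>.  The component of \<open>w\<^sub>k\<close> along the stable eigenvector of \<open>A\<^sub>s\<close> is then a stable
  recursion with vanishing input.  The component along the unstable eigenvector is recovered from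
  \<open>K w\<^sub>k\<close>, because \<open>K\<close> does not vanish on that eigenvector: otherwise \<open>P\<close> would not be the
  maximal solution of the Riccati equation.  Between touchdowns the two eigencomponents of \<open>e\<^sup>c\<close>
  are plain exponentials over a bounded time.\<close>

subsection \<open>Single-input Riccati equation\<close>

lemma inner_transpose_matrix:
  fixes M :: "real^'m^'n"
  shows "y \<bullet> (transpose M *v x) = (M *v y) \<bullet> x"
  by (metis dot_lmul_matrix inner_commute transpose_matrix_vector)

lemma matrix_eqI_inner:
  fixes M N :: "real^'m^'n"
  assumes "\<And>x y. y \<bullet> (M *v x) = y \<bullet> (N *v x)"
  shows "M = N"
  unfolding matrix_eq using assms by (metis vector_eq_rdot inner_commute)

lemma pos_semidef_inner_commute:
  assumes "pos_semidef M"
  shows "x \<bullet> (M *v y) = y \<bullet> (M *v x)"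
  using assms inner_transpose_matrix[of x M y] by (simp add: pos_semidef_def inner_commute)

lemma columnvector_mult_vec:
  fixes b :: "real^'n" and z :: "real^1"
  shows "columnvector b *v z = z $ 1 *\<^sub>R b"
  by (simp add: vec_eq_iff matrix_vector_mult_def columnvector_def)

lemma transpose_columnvector_mult_vec:
  fixes b x :: "real^'n"
  shows "(transpose (columnvector b :: real^1^'n) *v x) $ 1 = b \<bullet> x"
  by (simp add: matrix_vector_mult_def columnvector_def transpose_def inner_vec_def)

lemma matrix_inv_1x1_mult_vec:
  fixes S :: "real^1^1" and z :: "real^1"
  assumes "S $ 1 $ 1 \<noteq> 0"
  shows "(matrix_inv S *v z) $ 1 = z $ 1 / S $ 1 $ 1"
proof -
  have mult: "(M ** N) $ 1 $ 1 = M $ 1 $ 1 * N $ 1 $ 1" for M N :: "real^1^1"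
    by (simp add: matrix_matrix_mult_def)
  have "S ** mat (1 / S $ 1 $ 1) = mat 1" "mat (1 / S $ 1 $ 1) ** S = mat 1"
    using assms by (simp_all add: vec_eq_iff matrix_matrix_mult_def mat_def)
  \<comment> \<open>\<open>matrix_inv\<close> is a Hilbert choice among two-sided inverses, so it
    says nothing until one inverse has been exhibited.\<close>
  then have "\<exists>T. S ** T = mat 1 \<and> T ** S = mat 1"
    by blast
  then have "S ** matrix_inv S = mat 1"
    unfolding matrix_inv_def by (rule someI2_ex) blast
  then have "S $ 1 $ 1 * matrix_inv S $ 1 $ 1 = 1"
    using mult[of S "matrix_inv S"] by (simp add: mat_def)
  then have "matrix_inv S $ 1 $ 1 = 1 / S $ 1 $ 1"
    using assms by (simp add: field_simps)
  then show ?thesis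
    by (simp add: matrix_vector_mult_def)
qed

lemma single_input_weight:
  fixes b :: "real^'n" and P :: "real^'n^'n" and R :: "real^1^1"
  shows "(R + transpose (columnvector b) ** P ** columnvector b) $ 1 $ 1 = R $ 1 $ 1 + b \<bullet> (P *v b)"
proof -
  \<comment> \<open>Reading the entry off as the action on \<open>axis 1 1\<close> lets the rules
    for \<open>columnvector\<close> acting on vectors evaluate the product.\<close>
  have entry: "M $ 1 $ 1 = (M *v axis 1 1) $ 1" for M :: "real^1^1"
    by (simp add: matrix_vector_mult_def axis_def)
  have "(transpose (columnvector b) ** P ** columnvector b :: real^1^1) $ 1 $ 1 = b \<bullet> (P *v b)"
    unfolding entry by (simp add: transpose_columnvector_mult_vec columnvector_mult_vec
        matrix_vector_mult_scaleR flip: matrix_vector_mul_assoc del: transpose_matrix_vector)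
  then show ?thesis by simp
qed

lemma lqr_gain_single_input:
  fixes A P :: "real^'n^'n" and R :: "real^1^1"
  assumes "R $ 1 $ 1 + b \<bullet> (P *v b) \<noteq> 0"
  shows "(lqr_gain A (columnvector b) R P *v x) $ 1
    = b \<bullet> (P *v (A *v x)) / (R $ 1 $ 1 + b \<bullet> (P *v b))"
  using assms unfolding lqr_gain_def single_input_weight[symmetric]
  by (simp add: matrix_inv_1x1_mult_vec transpose_columnvector_mult_vec
      flip: matrix_vector_mul_assoc del: transpose_matrix_vector vector_add_component)

text \<open>With one input the inverse is division by the scalar \<open>r\<close>, and the
  correction term is a rank-one bilinear form. Testing against all \<open>x\<close> and
  \<open>y\<close> reduces the later Riccati arguments to real algebra.\<close>

lemma satisfies_dare_single_input_iff:
  fixes A Q P :: "real^'n^'n" and R :: "real^1^1" and b :: "real^'n"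
  defines "r \<equiv> R $ 1 $ 1 + b \<bullet> (P *v b)"
  assumes P: "pos_semidef P" and r: "r \<noteq> 0"
  shows "satisfies_dare A (columnvector b) Q R P \<longleftrightarrow>
    (\<forall>x y. y \<bullet> (P *v x) = (A *v y) \<bullet> (P *v (A *v x)) + y \<bullet> (Q *v x)
        - (b \<bullet> (P *v (A *v y))) * (b \<bullet> (P *v (A *v x))) / r)"
proof -
  define N where "N = transpose A ** P ** A + Q
         - (transpose A ** P ** columnvector b) ** matrix_inv (R + transpose (columnvector b) ** P ** columnvector b)
             ** (transpose (columnvector b) ** P ** A)"
  have "y \<bullet> (N *v x) = (A *v y) \<bullet> (P *v (A *v x)) + y \<bullet> (Q *v x)
        - (b \<bullet> (P *v (A *v y))) * (b \<bullet> (P *v (A *v x))) / r" for x y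
  proof -
    have "N *v x = transpose A *v (P *v (A *v x)) + Q *v x
        - transpose A *v (P *v (columnvector b *v (matrix_inv (R + transpose (columnvector b) ** P ** columnvector b)
             *v (transpose (columnvector b) *v (P *v (A *v x))))))"
      unfolding N_def
      by (simp add: matrix_vector_mult_diff_rdistrib matrix_vector_mult_add_rdistrib
          del: transpose_matrix_vector flip: matrix_vector_mul_assoc)
    also have "\<dots> = transpose A *v (P *v (A *v x)) + Q *v x
        - (b \<bullet> (P *v (A *v x)) / r) *\<^sub>R (transpose A *v (P *v b))"
      using r unfolding columnvector_mult_vec r_def single_input_weight[symmetric]
      by (simp add: matrix_inv_1x1_mult_vec transpose_columnvector_mult_vec matrix_vector_mult_scaleR
           del: transpose_matrix_vector vector_add_component)
    finally show ?thesis
      using pos_semidef_inner_commute[OF P, of "A *v y" b]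
      by (simp add: inner_add_right inner_diff_right inner_transpose_matrix del: transpose_matrix_vector)
  qed
  moreover have "satisfies_dare A (columnvector b) Q R P \<longleftrightarrow> (\<forall>x y. y \<bullet> (P *v x) = y \<bullet> (N *v x))"
    unfolding satisfies_dare_def N_def[symmetric] using matrix_eqI_inner by metis
  ultimately show ?thesis by simp
qed

text \<open>\<open>F - mat \<mu>\<close> and its transpose have the same determinant, hence are
  singular together; a kernel vector of the transpose is a left eigenvector.\<close>

lemma eigenvalue_transpose:
  fixes F :: "real^'n^'n"
  assumes "F *v v = \<mu> *\<^sub>R v" "v \<noteq> 0"
  obtains y where "y \<noteq> 0" "\<And>x. y \<bullet> (F *v x) = \<mu> * (y \<bullet> x)"
proof -
  have mat: "mat \<mu> *v x = \<mu> *\<^sub>R x" for x :: "real^'n"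
    by (simp add: vec_eq_iff matrix_vector_mult_def mat_def if_distrib if_distribR cong: if_cong)
  have "(F - mat \<mu>) *v v = 0"
    using assms(1) by (simp add: matrix_vector_mult_diff_rdistrib mat)
  then have "\<not> invertible (F - mat \<mu>)"
    using assms(2) unfolding invertible_left_inverse matrix_left_invertible_ker by blast
  then have "\<not> invertible (transpose (F - mat \<mu>))"
    by (simp add: invertible_det_nz)
  then obtain y where y: "y \<noteq> 0" "transpose (F - mat \<mu>) *v y = 0"
    unfolding invertible_left_inverse matrix_left_invertible_ker by blast
  have "y \<bullet> ((F - mat \<mu>) *v x) = 0" for x
    using y(2) inner_transpose_matrix[of x "F - mat \<mu>" y] by (simp add: inner_commute)
  then have "y \<bullet> (F *v x) = \<mu> * (y \<bullet> x)" for x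
    by (simp add: matrix_vector_mult_diff_rdistrib inner_diff_right mat)
  with y(1) show ?thesis by (rule that)
qed

text \<open>If the gain vanished on \<open>v\<close>, then \<open>\<mu>\<close> would remain an eigenvalue of the closed loop, with a
  left eigenvector \<open>y\<close> satisfying \<open>y \<bullet> b \<noteq> 0\<close>.  In terms of \<open>X = P' - P\<close> the Riccati equation is that
  of the closed loop with zero state weight, and \<open>X = c y y\<^sup>T\<close> with \<open>c > 0\<close> solves it, against
  the maximality of \<open>P\<close>.\<close>

lemma lqr_gain_unstable_mode_nonzero:
  fixes A Q P :: "real^'n^'n" and R :: "real^1^1"
  assumes R: "R $ 1 $ 1 > 0"
    and sol: "dare_solution A (columnvector b) Q R P"
    and v: "A *v v = \<mu> *\<^sub>R v" "v \<noteq> 0" and \<mu>: "\<mu> > 1"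
    and ctrl: "\<And>y. y \<noteq> 0 \<Longrightarrow> (\<And>x. y \<bullet> (A *v x) = \<mu> * (y \<bullet> x)) \<Longrightarrow> y \<bullet> b \<noteq> 0"
  shows "(lqr_gain A (columnvector b) R P *v v) $ 1 \<noteq> 0"
proof
  assume gain: "(lqr_gain A (columnvector b) R P *v v) $ 1 = 0"
  have P: "pos_semidef P" and dareP: "satisfies_dare A (columnvector b) Q R P"
    and maxP: "\<And>P'. pos_semidef P' \<Longrightarrow> satisfies_dare A (columnvector b) Q R P' \<Longrightarrow> pos_semidef (P - P')"
    using sol unfolding dare_solution_def by blast+
  define r where "r = R $ 1 $ 1 + b \<bullet> (P *v b)"
  have r: "r > 0"
    using R P unfolding r_def pos_semidef_def by (simp add: add_pos_nonneg)
  define K where "K = lqr_gain A (columnvector b) R P"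
  define \<kappa> where "\<kappa> x = (K *v x) $ 1" for x
  have bPA: "b \<bullet> (P *v (A *v x)) = r * \<kappa> x" for x
    using r lqr_gain_single_input[of R b P A x] by (simp add: \<kappa>_def K_def r_def)
  have F: "(A - columnvector b ** K) *v x = A *v x - \<kappa> x *\<^sub>R b" for x
    by (simp add: matrix_vector_mult_diff_rdistrib columnvector_mult_vec \<kappa>_def flip: matrix_vector_mul_assoc)
  have "(A - columnvector b ** K) *v v = \<mu> *\<^sub>R v"
    unfolding F using gain v(1) by (simp add: \<kappa>_def K_def)
  then obtain y where y0: "y \<noteq> 0" and yF: "\<And>x. y \<bullet> ((A - columnvector b ** K) *v x) = \<mu> * (y \<bullet> x)"
    using eigenvalue_transpose v(2) by blast
  define \<beta> where "\<beta> = y \<bullet> b"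
  have yA: "y \<bullet> (A *v x) = \<mu> * (y \<bullet> x) + \<kappa> x * \<beta>" for x
    using yF[of x] unfolding F by (simp add: inner_diff_right \<beta>_def)
  \<comment> \<open>If \<open>\<beta>\<close> were 0, \<open>yA\<close> would make \<open>y\<close>
    a left eigenvector of \<open>A\<close> itself, and \<open>ctrl\<close> would give
    \<open>y \<bullet> b \<noteq> 0\<close>.\<close>
  have \<beta>: "\<beta> \<noteq> 0"
    using ctrl[OF y0] yA unfolding \<beta>_def by auto
  \<comment> \<open>Inserting c y y^T into the closed-loop Riccati equation leaves 1 = \<mu>^2 r /
    (r + c \<beta>^2). This value of \<open>c\<close> solves it and scales the input weight from
    \<open>r\<close> to \<mu>^2 r.\<close>
  define c where "c = (\<mu>\<^sup>2 - 1) * r / \<beta>\<^sup>2"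
  have c: "c > 0" "c * \<beta>\<^sup>2 = (\<mu>\<^sup>2 - 1) * r"
    using \<mu> r \<beta> unfolding c_def by simp_all
  define X where "X = (\<chi> i j. c * (y $ i * y $ j))"
  have Xvec: "X *v x = (c * (y \<bullet> x)) *\<^sub>R y" for x
    by (simp add: X_def vec_eq_iff matrix_vector_mult_def inner_vec_def sum_distrib_left sum_distrib_right
        algebra_simps)
  define P' where "P' = P + X"
  have P'form: "u \<bullet> (P' *v w) = u \<bullet> (P *v w) + c * (y \<bullet> u) * (y \<bullet> w)" for u w
    by (simp add: P'_def matrix_vector_mult_add_rdistrib inner_add_right Xvec inner_commute[of u y])
  have P': "pos_semidef P'"
    unfolding pos_semidef_def
  proof
    have "transpose P = P"
      using P by (simp add: pos_semidef_def)
    then show "transpose P' = P'"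
      by (auto simp: P'_def X_def transpose_def vec_eq_iff algebra_simps)
    show "\<forall>x. 0 \<le> x \<bullet> (P' *v x)"
      using P c(1) unfolding P'form pos_semidef_def by (simp add: mult.assoc)
  qed
  have r': "R $ 1 $ 1 + b \<bullet> (P' *v b) = \<mu>\<^sup>2 * r"
    using c(2) unfolding P'form by (simp add: r_def \<beta>_def power2_eq_square algebra_simps)
  have "satisfies_dare A (columnvector b) Q R P'"
  proof (subst satisfies_dare_single_input_iff[OF P'])
    show "R $ 1 $ 1 + b \<bullet> (P' *v b) \<noteq> 0"
      using r \<mu> unfolding r' by simp
    show "\<forall>x z. z \<bullet> (P' *v x) = (A *v z) \<bullet> (P' *v (A *v x)) + z \<bullet> (Q *v x)
        - (b \<bullet> (P' *v (A *v z))) * (b \<bullet> (P' *v (A *v x))) / (R $ 1 $ 1 + b \<bullet> (P' *v b))"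
    proof (intro allI)
      fix x z
      have dare: "z \<bullet> (P *v x) = (A *v z) \<bullet> (P *v (A *v x)) + z \<bullet> (Q *v x) - r * \<kappa> z * \<kappa> x"
        using satisfies_dare_single_input_iff[THEN iffD1, OF P _ dareP, rule_format, of z x] r
        by (simp only: r_def[symmetric] bPA) simp
      have bP'A: "b \<bullet> (P' *v (A *v x)) = \<mu>\<^sup>2 * r * \<kappa> x + c * \<beta> * \<mu> * (y \<bullet> x)" for x
      proof -
        have "b \<bullet> (P' *v (A *v x)) = (r + c * \<beta>\<^sup>2) * \<kappa> x + c * \<beta> * \<mu> * (y \<bullet> x)"
          unfolding P'form bPA yA by (simp add: \<beta>_def power2_eq_square algebra_simps)
        then show ?thesis unfolding c(2) by (simp add: algebra_simps)
      qed
      have "(\<mu>\<^sup>2 * r * s + c * \<beta> * \<mu> * p) * (\<mu>\<^sup>2 * r * t + c * \<beta> * \<mu> * q)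
          = (r * s * t + c * (\<mu> * p + s * \<beta>) * (\<mu> * q + t * \<beta>) - c * p * q) * (\<mu>\<^sup>2 * r)" for s t p q
      proof -
        \<comment> \<open>The difference of the two sides contains the factor c \<beta>^2 - (\<mu>^2
          - 1) r, which vanishes by the choice of \<open>c\<close>. Here \<open>s\<close>,
          \<open>t\<close> stand for the gains on \<open>z\<close>, \<open>x\<close>, and
          \<open>p\<close>, \<open>q\<close> for their inner products with \<open>y\<close>.\<close>
        have "(\<mu>\<^sup>2 * r * s + c * \<beta> * \<mu> * p) * (\<mu>\<^sup>2 * r * t + c * \<beta> * \<mu> * q)
          - (r * s * t + c * (\<mu> * p + s * \<beta>) * (\<mu> * q + t * \<beta>) - c * p * q) * (\<mu>\<^sup>2 * r)
          = \<mu>\<^sup>2 * (c * \<beta>\<^sup>2 - (\<mu>\<^sup>2 - 1) * r) * (c * p * q - r * s * t)"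
          by (simp add: power2_eq_square algebra_simps)
        then show ?thesis unfolding c(2) by simp
      qed
      then have "(\<mu>\<^sup>2 * r * s + c * \<beta> * \<mu> * p) * (\<mu>\<^sup>2 * r * t + c * \<beta> * \<mu> * q) / (\<mu>\<^sup>2 * r)
          = r * s * t + c * (\<mu> * p + s * \<beta>) * (\<mu> * q + t * \<beta>) - c * p * q" for s t p q
        using r \<mu> by (simp add: divide_eq_eq)
      then show "z \<bullet> (P' *v x) = (A *v z) \<bullet> (P' *v (A *v x)) + z \<bullet> (Q *v x)
        - (b \<bullet> (P' *v (A *v z))) * (b \<bullet> (P' *v (A *v x))) / (R $ 1 $ 1 + b \<bullet> (P' *v b))"
        unfolding r' bP'A unfolding P'form yA dare by simp
    qed
  qed
  \<comment> \<open>P - P' = -X is negative in the direction \<open>y\<close>.\<close>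
  from maxP[OF P' this] have "0 \<le> y \<bullet> ((P - P') *v y)"
    by (simp add: pos_semidef_def)
  moreover have "y \<bullet> ((P - P') *v y) = - (c * (y \<bullet> y) * (y \<bullet> y))"
    by (simp add: matrix_vector_mult_diff_rdistrib inner_diff_right P'form)
  moreover have "c * (y \<bullet> y) * (y \<bullet> y) > 0"
    using c(1) y0 by simp
  ultimately show False by simp
qed

section \<open>Stable scalar recursions and the Lyapunov argument\<close>

lemma tendsto_zero_stable_recursion:
  fixes a h :: "nat \<Rightarrow> real"
  assumes rec: "\<And>k. a (Suc k) = \<nu> * a k + h k" and \<nu>: "\<bar>\<nu>\<bar> < 1" and h: "h \<longlonglongrightarrow> 0"
  shows "a \<longlonglongrightarrow> 0"
proof (rule LIMSEQ_I)
  fix e :: real assume "e > 0"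
  \<comment> \<open>Chosen so that |\<nu>| e/2 + d = e/2: once the input is below \<open>d\<close>,
    the bound e/2 reproduces itself and only a geometric term remains.\<close>
  define d where "d = (1 - \<bar>\<nu>\<bar>) * (e / 2)"
  have "d > 0" using \<open>e > 0\<close> \<nu> by (simp add: d_def)
  then obtain N where N: "\<And>n. n \<ge> N \<Longrightarrow> \<bar>h n\<bar> < d"
    using LIMSEQ_D[OF h] by auto
  have bound: "\<bar>a (N + n)\<bar> \<le> \<bar>\<nu>\<bar> ^ n * \<bar>a N\<bar> + e / 2" for n
  proof (induction n)
    case 0
    then show ?case using \<open>e > 0\<close> by simp
  next
    case (Suc n)
    have "\<bar>a (N + Suc n)\<bar> \<le> \<bar>\<nu>\<bar> * \<bar>a (N + n)\<bar> + \<bar>h (N + n)\<bar>"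
      using abs_triangle_ineq[of "\<nu> * a (N + n)" "h (N + n)"] by (simp add: rec abs_mult)
    also have "\<dots> \<le> \<bar>\<nu>\<bar> * (\<bar>\<nu>\<bar> ^ n * \<bar>a N\<bar> + e / 2) + d"
      using Suc N[of "N + n"] by (intro add_mono mult_left_mono) auto
    also have "\<dots> = \<bar>\<nu>\<bar> ^ Suc n * \<bar>a N\<bar> + e / 2"
      by (simp add: d_def field_simps)
    finally show ?case .
  qed
  have "(\<lambda>n. \<bar>\<nu>\<bar> ^ n * \<bar>a N\<bar>) \<longlonglongrightarrow> 0"
    using \<nu> by (intro tendsto_mult_left_zero LIMSEQ_power_zero) simp
  then obtain M where M: "\<And>n. n \<ge> M \<Longrightarrow> \<bar>\<nu>\<bar> ^ n * \<bar>a N\<bar> < e / 2"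
    using LIMSEQ_D[of _ 0 "e / 2"] \<open>e > 0\<close> by fastforce
  have "norm (a n - 0) < e" if "n \<ge> N + M" for n
  proof -
    have "M \<le> n - N" "N + (n - N) = n"
      using that by linarith+
    then show ?thesis
      using bound[of "n - N"] M[of "n - N"] by simp
  qed
  then show "\<exists>no. \<forall>n\<ge>no. norm (a n - 0) < e" by blast
qed

text \<open>\<open>V\<close> is nonnegative and decreasing, so its decrements vanish. As
  \<open>Q\<close> may be 0, they control only the input and not the whole state.\<close>

lemma lqr_gain_along_closed_loop_tendsto_zero:
  fixes A Q P :: "real^'n^'n" and R :: "real^1^1" and b :: "real^'n" and w :: "nat \<Rightarrow> real^'n"
  defines "K \<equiv> lqr_gain A (columnvector b) R P"
  assumes R: "R $ 1 $ 1 > 0" and Q: "pos_semidef Q" and P: "pos_semidef P"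
    and dare: "satisfies_dare A (columnvector b) Q R P"
    and rec: "\<And>k. w (Suc k) = A *v w k - (K *v w k) $ 1 *\<^sub>R b"
  shows "(\<lambda>k. (K *v w k) $ 1) \<longlonglongrightarrow> 0"
proof -
  define r where "r = R $ 1 $ 1 + b \<bullet> (P *v b)"
  have r: "r > 0" "R $ 1 $ 1 + b \<bullet> (P *v b) \<noteq> 0"
    using R P unfolding r_def pos_semidef_def by (simp_all add: add_pos_nonneg less_imp_neq[symmetric])
  define \<kappa> where "\<kappa> k = (K *v w k) $ 1" for k
  define V where "V k = w k \<bullet> (P *v w k)" for k
  have bPA: "b \<bullet> (P *v (A *v w k)) = r * \<kappa> k" for k
    using r lqr_gain_single_input[of R b P A "w k"] by (simp add: \<kappa>_def K_def r_def)
  \<comment> \<open>The multiples of the squared input are r from the Riccati equation, -2r from the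
    cross term and r - R from the quadratic term, in total -R.\<close>
  have V: "V (Suc k) = V k - w k \<bullet> (Q *v w k) - R $ 1 $ 1 * (\<kappa> k)\<^sup>2" for k
  proof -
    have "V k = (A *v w k) \<bullet> (P *v (A *v w k)) + w k \<bullet> (Q *v w k) - r * (\<kappa> k)\<^sup>2"
      using satisfies_dare_single_input_iff[THEN iffD1, OF P r(2) dare, rule_format, of "w k" "w k"] r(1)
      unfolding r_def[symmetric] bPA V_def by (simp only: power2_eq_square) (simp add: field_simps)
    moreover have "V (Suc k) = (A *v w k) \<bullet> (P *v (A *v w k)) - 2 * \<kappa> k * (b \<bullet> (P *v (A *v w k)))
        + (\<kappa> k)\<^sup>2 * (b \<bullet> (P *v b))"
      using pos_semidef_inner_commute[OF P, of "A *v w k" b]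
      unfolding V_def rec \<kappa>_def[symmetric]
      by (simp add: matrix_vector_mult_diff_distrib matrix_vector_mult_scaleR inner_diff_left inner_diff_right
          power2_eq_square algebra_simps)
    moreover have "b \<bullet> (P *v b) = r - R $ 1 $ 1"
      by (simp add: r_def)
    ultimately show ?thesis
      unfolding bPA by (simp add: power2_eq_square algebra_simps)
  qed
  have Qk: "0 \<le> w k \<bullet> (Q *v w k)" and V0: "0 \<le> V k" for k
    using Q P unfolding pos_semidef_def V_def by auto
  have drop: "R $ 1 $ 1 * (\<kappa> k)\<^sup>2 \<le> V k - V (Suc k)" for k
    using V[of k] Qk[of k] by simp
  have nonneg: "0 \<le> R $ 1 $ 1 * (\<kappa> k)\<^sup>2" for k
    using R by simp
  have "V (Suc k) \<le> V k" for k
    using drop[of k] nonneg[of k] by linarith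
  then have "decseq V" by (rule decseq_SucI)
  then obtain L where "V \<longlonglongrightarrow> L"
    using decseq_convergent V0 by blast
  then have "(\<lambda>k. V k - V (Suc k)) \<longlonglongrightarrow> L - L"
    by (intro tendsto_diff LIMSEQ_Suc)
  then have lim: "(\<lambda>k. V k - V (Suc k)) \<longlonglongrightarrow> 0" by simp
  have "(\<lambda>k. R $ 1 $ 1 * (\<kappa> k)\<^sup>2) \<longlonglongrightarrow> 0"
    by (rule tendsto_sandwich[OF _ _ tendsto_const lim]) (use drop nonneg in auto)
  then have "(\<lambda>k. (R $ 1 $ 1 * (\<kappa> k)\<^sup>2) / R $ 1 $ 1) \<longlonglongrightarrow> 0"
    by (rule tendsto_divide_zero)
  then have "(\<lambda>k. (\<kappa> k)\<^sup>2) \<longlonglongrightarrow> 0"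
    using R by simp
  then have "(\<lambda>k. sqrt ((\<kappa> k)\<^sup>2)) \<longlonglongrightarrow> sqrt 0"
    by (rule tendsto_real_sqrt)
  then show ?thesis
    by (simp add: tendsto_rabs_zero_iff \<kappa>_def)
qed

subsection \<open>Matrix exponential and jump flow in eigencoordinates\<close>

lemma mat_pow_Suc_mult_vec: "mat_pow M (Suc n) *v x = M *v (mat_pow M n *v x)"
  by (simp add: mat_pow_def matrix_vector_mul_assoc)

text \<open>Left multiplication by \<open>M\<close> is bounded by some \<open>C\<close>, so the
  terms are dominated by those of the scalar series of exp C. Convergence is what lets the sum in
  \<open>mat_exp\<close> be evaluated termwise.\<close>

lemma summable_mat_exp:
  fixes M :: "real^'n^'n"
  shows "summable (\<lambda>n. mat_pow M n /\<^sub>R fact n)"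
proof -
  have "linear ((**) M :: real^'n^'n \<Rightarrow> _)"
    by (auto intro!: linearI simp: vec_eq_iff matrix_matrix_mult_def
        algebra_simps sum.distrib sum_distrib_left)
  then obtain C where C: "C > 0" "\<And>N :: real^'n^'n. norm (M ** N) \<le> C * norm N"
    using linear_bounded_pos by blast
  have bound: "norm (mat_pow M n) \<le> C ^ n * norm (mat 1 :: real^'n^'n)" for n
  proof (induction n)
    case (Suc n)
    have "norm (mat_pow M (Suc n)) \<le> C * norm (mat_pow M n)"
      using C(2) by (simp add: mat_pow_def)
    also have "\<dots> \<le> C * (C ^ n * norm (mat 1 :: real^'n^'n))"
      using Suc C(1) by simp
    finally show ?case by (simp add: mult.assoc)
  qed (simp add: mat_pow_def)
  have "summable (\<lambda>n. (C ^ n /\<^sub>R fact n) * norm (mat 1 :: real^'n^'n))"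
    by (intro summable_mult2 summable_exp_generic)
  then show ?thesis
    by (rule summable_comparison_test')
      (use bound in \<open>auto simp: divide_simps mult.commute intro: mult_left_mono\<close>)
qed

lemma mat_exp_eigenvector:
  fixes M :: "real^'n^'n"
  assumes "M *v v = m *\<^sub>R v"
  shows "mat_exp M *v v = exp m *\<^sub>R v"
proof -
  have pow: "mat_pow M n *v v = m ^ n *\<^sub>R v" for n
    by (induction n) (simp_all add: mat_pow_Suc_mult_vec matrix_vector_mult_scaleR assms,
        simp add: mat_pow_def)
  have lin: "bounded_linear (\<lambda>N :: real^'n^'n. N *v v)"
    unfolding linear_conv_bounded_linear[symmetric]
    by (rule linearI) (simp_all add: matrix_vector_mult_add_rdistrib scaleR_matrix_vector_assoc)
  have "mat_exp M *v v = (\<Sum>n. (mat_pow M n /\<^sub>R fact n) *v v)"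
    unfolding mat_exp_def by (rule bounded_linear.suminf[OF lin summable_mat_exp])
  also have "\<dots> = (\<Sum>n. (m ^ n /\<^sub>R fact n) *\<^sub>R v)"
    by (simp add: scaleR_matrix_vector_assoc[symmetric] pow)
  also have "\<dots> = exp m *\<^sub>R v"
    unfolding exp_def
    by (rule bounded_linear.suminf[OF bounded_linear_scaleR_left summable_exp_generic, symmetric])
  finally show ?thesis .
qed

section \<open>Eigencoordinates of the walking model\<close>

lemma inner_2: "x \<bullet> y = x $ 1 * y $ 1 + x $ 2 * y $ 2" for x y :: "real^2"
  by (simp add: inner_vec_def sum_2)

lemma A_lam_eigenvector:
  "A_lam l *v vector [1, l] = l *\<^sub>R vector [1, l]"
  "A_lam l *v vector [1, - l] = (- l) *\<^sub>R vector [1, - l]"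
  by (simp_all add: A_lam_def vec_eq_iff forall_2 matrix_vector_mult_def sum_2 power2_eq_square)

lemma A_lam_left_eigenvector:
  "vector [l, 1] \<bullet> (A_lam l *v x) = l * (vector [l, 1] \<bullet> x)"
  "vector [l, - 1] \<bullet> (A_lam l *v x) = (- l) * (vector [l, - 1] \<bullet> x)"
  by (simp_all add: A_lam_def inner_2 matrix_vector_mult_def sum_2 power2_eq_square algebra_simps)

lemma A_step_eigenvector:
  "A_step l T *v vector [1, l] = exp (l * T) *\<^sub>R vector [1, l]"
  "A_step l T *v vector [1, - l] = exp (- l * T) *\<^sub>R vector [1, - l]"
  unfolding A_step_def
  by (rule mat_exp_eigenvector; simp add: A_lam_eigenvector mult.commute flip: scaleR_matrix_vector_assoc)+

text \<open>Each left eigenvector is orthogonal to the right eigenvector of the opposite rate and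
  has inner product 2l with its own.\<close>

lemma eigenbasis_expansion:
  assumes "l \<noteq> 0"
  shows "x = ((vector [l, 1] \<bullet> x) / (2 * l)) *\<^sub>R vector [1, l]
    + ((vector [l, - 1] \<bullet> x) / (2 * l)) *\<^sub>R (vector [1, - l] :: real^2)"
  using assms by (simp add: vec_eq_iff forall_2 inner_2 field_simps)

lemma A_step_left_eigenvector:
  assumes "l \<noteq> 0"
  shows "vector [l, 1] \<bullet> (A_step l T *v x) = exp (l * T) * (vector [l, 1] \<bullet> x)"
    and "vector [l, - 1] \<bullet> (A_step l T *v x) = exp (- l * T) * (vector [l, - 1] \<bullet> x)"
proof -
  define p q where "p = vector [l, 1] \<bullet> x / (2 * l)" and "q = vector [l, - 1] \<bullet> x / (2 * l)"
  have "A_step l T *v x = A_step l T *v (p *\<^sub>R vector [1, l] + q *\<^sub>R vector [1, - l])"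
    using eigenbasis_expansion[OF assms, of x] by (simp add: p_def q_def)
  then have "A_step l T *v x = (p * exp (l * T)) *\<^sub>R vector [1, l] + (q * exp (- l * T)) *\<^sub>R vector [1, - l]"
    by (simp only: matrix_vector_right_distrib matrix_vector_mult_scaleR A_step_eigenvector scaleR_scaleR)
  then show "vector [l, 1] \<bullet> (A_step l T *v x) = exp (l * T) * (vector [l, 1] \<bullet> x)"
    "vector [l, - 1] \<bullet> (A_step l T *v x) = exp (- l * T) * (vector [l, - 1] \<bullet> x)"
    using assms by (simp_all add: inner_2 p_def q_def field_simps)
qed

text \<open>The function exp(-l s) f(s) has derivative 0 on the open interval. At \<open>a\<close>,
  where a jump may occur, continuity from the right is enough to carry the constant up to the
  endpoint.\<close>

lemma exp_flow:
  fixes f :: "real \<Rightarrow> real"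
  assumes right: "(f \<longlongrightarrow> f a) (at_right a)"
    and deriv: "\<And>t. a < t \<Longrightarrow> t < b \<Longrightarrow> (f has_real_derivative l * f t) (at t)"
    and t: "a \<le> t" "t < b"
  shows "f t = exp (l * (t - a)) * f a"
proof (cases "a = t")
  case False
  with t have "a < t" by simp
  define h where "h s = exp (- l * s) * f s" for s
  have dh: "(h has_real_derivative 0) (at s)" if "a < s" "s < b" for s
    unfolding h_def by (auto intro!: derivative_eq_intros deriv[OF that])
  have "continuous_on {a..t} h"
    unfolding continuous_on_def
  proof
    fix s assume s: "s \<in> {a..t}"
    show "(h \<longlongrightarrow> h s) (at s within {a..t})"
    proof (cases "s = a")
      case True
      have "(h \<longlongrightarrow> h a) (at_right a)"
        unfolding h_def by (intro tendsto_intros right)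
      then show ?thesis
        using \<open>a < t\<close> True by (simp add: at_within_Icc_at_right)
    next
      case False
      then have "isCont h s"
        using dh[of s] s t by (auto intro: DERIV_isCont)
      then show ?thesis
        unfolding isCont_def by (rule tendsto_within_subset) simp
    qed
  qed
  then have "h t = h a"
    using \<open>a < t\<close> dh t by (intro DERIV_isconst_end) auto
  then have "exp (l * t) * (exp (- l * t) * f t) = exp (l * t) * (exp (- l * a) * f a)"
    by (simp add: h_def)
  then show ?thesis
    by (simp add: mult.assoc[symmetric] right_diff_distrib flip: exp_add)
qed simp

text \<open>Turns the tracking error into a single jump flow; both trajectories take post-jump
  values at the common jump times, so the difference does too.\<close>

lemma jump_flow_solution_diff:
  assumes "jump_flow_solution A b \<tau> s x0 x" "jump_flow_solution A b \<tau> s' y0 y"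
  shows "jump_flow_solution A b \<tau> (\<lambda>k. s k - s' k) (x0 - y0) (\<lambda>t. x t - y t)"
  unfolding jump_flow_solution_def
proof (intro conjI allI impI)
  show "x 0 - y 0 = x0 - y0"
    using assms by (simp add: jump_flow_solution_def)
  show "((\<lambda>t. x t - y t) has_vector_derivative A *v (x t - y t)) (at t within {0..})"
    if "t \<ge> 0" "\<forall>k\<ge>1. t \<noteq> \<tau> k" for t
    using assms that unfolding jump_flow_solution_def matrix_vector_mult_diff_distrib
    by (intro has_vector_derivative_diff) auto
  fix k :: nat assume "k \<ge> 1"
  then obtain xm ym where
    x: "(x \<longlongrightarrow> xm) (at_left (\<tau> k))" "(x \<longlongrightarrow> xm - s k *\<^sub>R b) (at_right (\<tau> k))" "x (\<tau> k) = xm - s k *\<^sub>R b"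
    and y: "(y \<longlongrightarrow> ym) (at_left (\<tau> k))" "(y \<longlongrightarrow> ym - s' k *\<^sub>R b) (at_right (\<tau> k))" "y (\<tau> k) = ym - s' k *\<^sub>R b"
    using assms unfolding jump_flow_solution_def by metis
  have "(xm - ym) - (s k - s' k) *\<^sub>R b = (xm - s k *\<^sub>R b) - (ym - s' k *\<^sub>R b)"
    by (simp add: algebra_simps)
  then show "\<exists>xminus xplus. ((\<lambda>t. x t - y t) \<longlongrightarrow> xminus) (at_left (\<tau> k))
      \<and> ((\<lambda>t. x t - y t) \<longlongrightarrow> xplus) (at_right (\<tau> k))
      \<and> xplus = xminus - (s k - s' k) *\<^sub>R b \<and> x (\<tau> k) - y (\<tau> k) = xplus"
    using tendsto_diff[OF x(1) y(1)] tendsto_diff[OF x(2) y(2)] x(3) y(3) by metis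
qed

section \<open>Touchdown flow seen through a left eigenvector\<close>

lemma touchdown_between:
  assumes "T > 0" "touchdown T k < t" "t < touchdown T (Suc k)"
  shows "t \<noteq> touchdown T j"
proof
  assume "t = touchdown T j"
  then have "real k < real j" "real j < real (Suc k)"
    using assms by (simp_all add: touchdown_def)
  then show False by simp
qed

context
  fixes A :: "real^'n^'n" and b :: "real^'n" and T :: real and s :: "nat \<Rightarrow> real" and x0 :: "real^'n"
    and e :: "real \<Rightarrow> real^'n" and y :: "real^'n" and l :: real
  assumes T: "T > 0" and e: "jump_flow_solution A b (touchdown T) s x0 e"
    and left: "\<And>x. y \<bullet> (A *v x) = l * (y \<bullet> x)"
begin

lemma jump_flow_left_eigenvector:
  assumes "k \<ge> 1" "touchdown T k \<le> t" "t < touchdown T (Suc k)"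
  shows "y \<bullet> e t = exp (l * (t - touchdown T k)) * (y \<bullet> e (touchdown T k))"
proof (rule exp_flow[where f = "\<lambda>t. y \<bullet> e t", OF _ _ assms(2,3)])
  have "(e \<longlongrightarrow> e (touchdown T k)) (at_right (touchdown T k))"
    using e \<open>k \<ge> 1\<close> unfolding jump_flow_solution_def by metis
  then show "((\<lambda>t. y \<bullet> e t) \<longlongrightarrow> y \<bullet> e (touchdown T k)) (at_right (touchdown T k))"
    by (intro tendsto_intros)
  fix t assume t: "touchdown T k < t" "t < touchdown T (Suc k)"
  \<comment> \<open>The flow is differentiable only relative to \<open>{0..}\<close>; since
    \<open>t\<close> is interior, this is an ordinary two-sided derivative.\<close>
  have "touchdown T k > 0"
    using T \<open>k \<ge> 1\<close> by (simp add: touchdown_def)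
  with t have "t > 0" by simp
  then have "(e has_vector_derivative A *v e t) (at t within {0..})"
    using e touchdown_between[OF T t] unfolding jump_flow_solution_def by auto
  then have "(e has_vector_derivative A *v e t) (at t within {0<..})"
    by (rule has_vector_derivative_within_subset) auto
  then have "(e has_vector_derivative A *v e t) (at t)"
    using \<open>t > 0\<close> has_vector_derivative_within_open[of t "{0<..}" e]
    by (metis greaterThan_iff open_greaterThan)
  then have "((\<lambda>t. y \<bullet> e t) has_vector_derivative y \<bullet> (A *v e t)) (at t)"
    by (rule bounded_linear.has_vector_derivative[OF bounded_linear_inner_right])
  then show "((\<lambda>t. y \<bullet> e t) has_real_derivative l * (y \<bullet> e t)) (at t)"
    unfolding left has_real_derivative_iff_has_vector_derivative .
qed

text \<open>The exponential formula stops short of the next touchdown, where \<open>e\<close> is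
  already post-jump. It therefore fixes the left limit, from which the jump is subtracted.\<close>

lemma jump_flow_left_eigenvector_step:
  assumes "k \<ge> 1"
  shows "y \<bullet> e (touchdown T (Suc k)) = exp (l * T) * (y \<bullet> e (touchdown T k)) - s (Suc k) * (y \<bullet> b)"
proof -
  let ?a = "touchdown T k" and ?b = "touchdown T (Suc k)"
  have ab: "?b - ?a = T" "?a < ?b"
    using T by (simp_all add: touchdown_def algebra_simps)
  obtain xm where xm: "(e \<longlongrightarrow> xm) (at_left ?b)" "e ?b = xm - s (Suc k) *\<^sub>R b"
    using e unfolding jump_flow_solution_def by (metis le_add1 plus_1_eq_Suc)
  have "((\<lambda>t. exp (l * (t - ?a)) * (y \<bullet> e ?a)) \<longlongrightarrow> exp (l * (?b - ?a)) * (y \<bullet> e ?a)) (at_left ?b)"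
    by (intro tendsto_intros)
  moreover have "eventually (\<lambda>t. exp (l * (t - ?a)) * (y \<bullet> e ?a) = y \<bullet> e t) (at_left ?b)"
    using eventually_at_left_real[OF ab(2)]
    by eventually_elim (rule jump_flow_left_eigenvector[OF assms, symmetric]; simp)
  ultimately have "((\<lambda>t. y \<bullet> e t) \<longlongrightarrow> exp (l * (?b - ?a)) * (y \<bullet> e ?a)) (at_left ?b)"
    by (rule Lim_transform_eventually)
  moreover have "((\<lambda>t. y \<bullet> e t) \<longlongrightarrow> y \<bullet> xm) (at_left ?b)"
    by (intro tendsto_intros xm(1))
  ultimately have "y \<bullet> xm = exp (l * T) * (y \<bullet> e ?a)"
    unfolding ab(1) using tendsto_unique[OF trivial_limit_at_left_real] by blast
  then show ?thesis
    unfolding xm(2) by (simp add: inner_diff_right)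
qed

text \<open>Within one period the coordinate grows at most by the factor exp(|l| T), whatever the
  sign of \<open>l\<close>, so its touchdown values control all times.\<close>

lemma jump_flow_left_eigenvector_tendsto_zero:
  assumes "(\<lambda>k. y \<bullet> e (touchdown T (Suc k))) \<longlonglongrightarrow> 0"
  shows "((\<lambda>t. y \<bullet> e t) \<longlongrightarrow> 0) at_top"
proof -
  \<comment> \<open>Touchdown N + 1 lies at (N + 1/2) T, so \<open>Suc (N t)\<close> is the last
    touchdown up to \<open>t\<close>, provided t is at least T/2; earlier, \<open>nat\<close>
    truncates a negative floor.\<close>
  define N where "N t = nat \<lfloor>t / T - 1/2\<rfloor>" for t
  have N: "filterlim N sequentially at_top"
    unfolding N_def
  proof (rule filterlim_compose[OF filterlim_nat_sequentially])
    have "filterlim (\<lambda>t. - 1/2 + 1 / T * t) at_top at_top"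
      using T by (intro filterlim_tendsto_add_at_top[OF tendsto_const]
          filterlim_tendsto_pos_mult_at_top[OF tendsto_const] filterlim_ident) simp
    then show "filterlim (\<lambda>t. \<lfloor>t / T - 1/2\<rfloor>) at_top at_top"
      by (intro filterlim_compose[OF filterlim_floor_sequentially]) simp
  qed
  have "((\<lambda>t. exp (\<bar>l\<bar> * T) * \<bar>y \<bullet> e (touchdown T (Suc (N t)))\<bar>) \<longlongrightarrow> exp (\<bar>l\<bar> * T) * \<bar>0\<bar>) at_top"
    by (intro tendsto_intros filterlim_compose[OF assms N])
  then have lim: "((\<lambda>t. exp (\<bar>l\<bar> * T) * \<bar>y \<bullet> e (touchdown T (Suc (N t)))\<bar>) \<longlongrightarrow> 0) at_top"
    by simp
  show ?thesis
  proof (rule Lim_null_comparison[OF _ lim])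
    show "\<forall>\<^sub>F t in at_top. norm (y \<bullet> e t) \<le> exp (\<bar>l\<bar> * T) * \<bar>y \<bullet> e (touchdown T (Suc (N t)))\<bar>"
      using eventually_ge_at_top[of "T / 2"]
    proof eventually_elim
      case (elim t)
      let ?k = "Suc (N t)"
      have "0 \<le> t / T - 1/2"
        using elim T by (simp add: field_simps)
      then have "real (N t) \<le> t / T - 1/2" "t / T - 1/2 < real (N t) + 1"
        unfolding N_def by linarith+
      then have t: "touchdown T ?k \<le> t" "t < touchdown T (Suc ?k)"
        using T by (simp_all add: touchdown_def field_simps)
      have "touchdown T (Suc ?k) = touchdown T ?k + T"
        by (simp add: touchdown_def algebra_simps)
      with t have d: "0 \<le> t - touchdown T ?k" "t - touchdown T ?k \<le> T"
        by linarith+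
      have "l * (t - touchdown T ?k) \<le> \<bar>l\<bar> * T"
        using d by (intro mult_mono) auto
      then show ?case
        by (subst jump_flow_left_eigenvector[OF _ t]) (simp_all add: abs_mult mult_right_mono)
    qed
  qed
qed

end

subsection \<open>Convergence\<close>

theorem lemma1:
  fixes g z_sc Ts vd lam :: real
    and Q P :: "real^2^2" and R :: "real^1^1" and K :: "real^2^1"
    and u :: "nat \<Rightarrow> real"
    and x xd xc ec :: "real \<Rightarrow> real^2"
  assumes "g > 0" and "z_sc > 0" and "Ts > 0"
    and "lam = sqrt (g / z_sc)"
    and "pos_def R" and "pos_semidef Q"
    and "dare_solution (A_step lam Ts) (B_step lam Ts) Q R P"
    and "K = lqr_gain (A_step lam Ts) (B_step lam Ts) R P"
    and "jump_flow_solution (A_lam lam) B1 (touchdown Ts) (\<lambda>k. Ts * vd)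
           (vector [0, vd * Ts * lam / (2 * sinh (1/2 * lam * Ts))]) xd"
    and "x 0 = vector [0, 0]"
    and "jump_flow_solution (A_lam lam) B1 (touchdown Ts) u (x 0) xc"
    and "ec = (\<lambda>t. xd t - xc t)"
    and "\<And>k. k \<ge> 1 \<Longrightarrow>
           u (k + 1) = Ts * vd
             - (K *v ((A_step lam Ts - mat 1) *v Lim (at_right (touchdown Ts k)) ec)) $ 1"
  shows "(ec \<longlongrightarrow> 0) at_top \<and> ((\<lambda>t. dist (xc t) (xd t)) \<longlongrightarrow> 0) at_top"
proof -
  have lam: "lam > 0"
    using assms(1,2,4) by simp
  note Ts = \<open>Ts > 0\<close>
  define M where "M = A_step lam Ts"
  define b where "b = (M - mat 1) *v B1"
  define \<mu> \<nu> where "\<mu> = exp (lam * Ts)" and "\<nu> = exp (- lam * Ts)"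
  have \<mu>: "\<mu> > 1" and \<nu>: "0 < \<nu>" "\<nu> < 1"
    using lam Ts by (simp_all add: \<mu>_def \<nu>_def)
  define yp ym :: "real^2" where "yp = vector [lam, 1]" and "ym = vector [lam, - 1]"
  define vp vm :: "real^2" where "vp = vector [1, lam]" and "vm = vector [1, - lam]"
  have yp: "yp \<bullet> (M *v z) = \<mu> * (yp \<bullet> z)" and ym: "ym \<bullet> (M *v z) = \<nu> * (ym \<bullet> z)" for z
    using A_step_left_eigenvector[of lam Ts z] lam by (simp_all add: M_def yp_def ym_def \<mu>_def \<nu>_def)
  have vp: "M *v vp = \<mu> *\<^sub>R vp" and vm: "M *v vm = \<nu> *\<^sub>R vm"
    using A_step_eigenvector[of lam Ts] by (simp_all add: M_def vp_def vm_def \<mu>_def \<nu>_def)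
  have expansion: "z = (yp \<bullet> z / (2 * lam)) *\<^sub>R vp + (ym \<bullet> z / (2 * lam)) *\<^sub>R vm" for z
    using eigenbasis_expansion[of lam z] lam by (simp add: yp_def ym_def vp_def vm_def)
  have B: "B_step lam Ts = columnvector b"
    by (simp add: B_step_def b_def M_def)
  have R: "R $ 1 $ 1 > 0"
  proof -
    have "axis 1 1 \<bullet> (R *v axis 1 1) > 0"
      using \<open>pos_def R\<close> unfolding pos_def_def by (simp add: axis_eq_0_iff)
    then show ?thesis
      by (simp add: matrix_vector_mult_basis column_def inner_axis')
  qed
  have dare: "dare_solution M (columnvector b) Q R P"
    and K: "K = lqr_gain M (columnvector b) R P"
    using assms(7,8) unfolding B M_def by simp_all
  have P: "pos_semidef P" and sat: "satisfies_dare M (columnvector b) Q R P"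
    using dare unfolding dare_solution_def by blast+

  have flow: "jump_flow_solution (A_lam lam) B1 (touchdown Ts) (\<lambda>k. Ts * vd - u k)
      (vector [0, vd * Ts * lam / (2 * sinh (1/2 * lam * Ts))] - x 0) ec"
    unfolding assms(12) by (rule jump_flow_solution_diff[OF assms(9,11)])
  define E where "E k = ec (touchdown Ts (Suc k))" for k
  define w where "w k = (M - mat 1) *v E k" for k
  define \<kappa> where "\<kappa> k = (K *v w k) $ 1" for k
  \<comment> \<open>The law sets the jump at touchdown k + 2 from the error just after touchdown k +
    1, which is \<open>E k\<close>. The first step length \<open>u 1\<close> is free and enters only
    through the initial value \<open>E 0\<close>.\<close>
  have input: "Ts * vd - u (Suc (Suc k)) = \<kappa> k" for k
  proof -
    have "(ec \<longlongrightarrow> E k) (at_right (touchdown Ts (Suc k)))"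
      using flow unfolding jump_flow_solution_def E_def by (metis le_add1 plus_1_eq_Suc)
    then have "Lim (at_right (touchdown Ts (Suc k))) ec = E k"
      by (rule tendsto_Lim[OF trivial_limit_at_right_real])
    then show ?thesis
      using assms(13)[of "Suc k"] by (simp add: \<kappa>_def w_def M_def)
  qed
  have stepp: "yp \<bullet> E (Suc k) = yp \<bullet> (M *v E k - \<kappa> k *\<^sub>R B1)" for k
    using jump_flow_left_eigenvector_step[OF Ts flow A_lam_left_eigenvector(1), of "Suc k"]
    unfolding input yp_def[symmetric] E_def[symmetric] \<mu>_def[symmetric] by (simp add: inner_diff_right yp)
  have stepm: "ym \<bullet> E (Suc k) = ym \<bullet> (M *v E k - \<kappa> k *\<^sub>R B1)" for k
    using jump_flow_left_eigenvector_step[OF Ts flow A_lam_left_eigenvector(2), of "Suc k"]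
    unfolding input ym_def[symmetric] E_def[symmetric] \<nu>_def[symmetric] by (simp add: inner_diff_right ym)
  \<comment> \<open>The two eigencoordinates determine a vector, so the scalar steps combine into a
    vector recursion.\<close>
  have E_rec: "E (Suc k) = M *v E k - \<kappa> k *\<^sub>R B1" for k
    using expansion[of "E (Suc k)"] expansion[of "M *v E k - \<kappa> k *\<^sub>R B1"] unfolding stepp stepm by simp
  \<comment> \<open>M - I commutes with \<open>M\<close> and sends \<open>B1\<close> to
    \<open>b\<close>, which turns the error recursion into the LQR closed loop.\<close>
  have w_rec: "w (Suc k) = M *v w k - \<kappa> k *\<^sub>R b" for k
    unfolding w_def E_rec b_def
    by (simp add: matrix_vector_mult_diff_rdistrib matrix_vector_mult_diff_distrib matrix_vector_mult_scaleR
        algebra_simps)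
  have \<kappa>0: "\<kappa> \<longlonglongrightarrow> 0"
    using lqr_gain_along_closed_loop_tendsto_zero[OF R \<open>pos_semidef Q\<close> P sat, of w] w_rec
    unfolding \<kappa>_def K by simp

  have qw: "(\<lambda>k. ym \<bullet> w k) \<longlonglongrightarrow> 0"
  proof (rule tendsto_zero_stable_recursion)
    show "ym \<bullet> w (Suc k) = \<nu> * (ym \<bullet> w k) + (- \<kappa> k * (ym \<bullet> b))" for k
      unfolding w_rec by (simp add: inner_diff_right ym)
    show "\<bar>\<nu>\<bar> < 1" using \<nu> by simp
    have "(\<lambda>k. - \<kappa> k * (ym \<bullet> b)) \<longlonglongrightarrow> - 0 * (ym \<bullet> b)"
      by (intro tendsto_intros \<kappa>0)
    then show "(\<lambda>k. - \<kappa> k * (ym \<bullet> b)) \<longlonglongrightarrow> 0" by simp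
  qed
  define \<alpha> \<beta> where "\<alpha> = (K *v vp) $ 1 / (2 * lam)" and "\<beta> = (K *v vm) $ 1 / (2 * lam)"
  have "(K *v vp) $ 1 \<noteq> 0"
    unfolding K
  proof (rule lqr_gain_unstable_mode_nonzero[OF R dare vp _ \<mu>])
    show "vp \<noteq> 0"
      by (simp add: vp_def vec_eq_iff forall_2)
    fix y :: "real^2" assume y: "y \<noteq> 0" "\<And>z. y \<bullet> (M *v z) = \<mu> * (y \<bullet> z)"
    \<comment> \<open>Controllability of the unstable mode: a left eigenvector for \<mu> is
      orthogonal to \<open>vm\<close> because \<mu> and \<nu> differ. This forces its first entry to
      be nonzero, and \<mu> - 1 times that entry is \<open>y \<bullet> b\<close>.\<close>
    have "\<nu> * (y \<bullet> vm) = \<mu> * (y \<bullet> vm)"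
      using y(2)[of vm] unfolding vm by simp
    then have "y \<bullet> vm = 0"
      using \<mu> \<nu> by simp
    then have "y $ 1 = lam * y $ 2"
      by (simp add: vm_def inner_2)
    with y(1) lam have "y $ 1 \<noteq> 0"
      by (auto simp: vec_eq_iff forall_2)
    moreover have "y \<bullet> b = (\<mu> - 1) * y $ 1"
      unfolding b_def
      by (simp only: matrix_vector_mult_diff_rdistrib inner_diff_right y(2))
        (simp add: B1_def inner_2 algebra_simps)
    ultimately show "y \<bullet> b \<noteq> 0"
      using \<mu> by simp
  qed
  then have \<alpha>: "\<alpha> \<noteq> 0"
    using lam by (simp add: \<alpha>_def)
  have "\<kappa> k = \<alpha> * (yp \<bullet> w k) + \<beta> * (ym \<bullet> w k)" for k
  proof -
    have "\<kappa> k = (K *v ((yp \<bullet> w k / (2 * lam)) *\<^sub>R vp + (ym \<bullet> w k / (2 * lam)) *\<^sub>R vm)) $ 1"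
      using expansion[of "w k"] by (simp add: \<kappa>_def)
    then show ?thesis
      by (simp add: matrix_vector_right_distrib matrix_vector_mult_scaleR \<alpha>_def \<beta>_def field_simps)
  qed
  then have "yp \<bullet> w k = (\<kappa> k - \<beta> * (ym \<bullet> w k)) / \<alpha>" for k
    using \<alpha> by (simp add: field_simps)
  moreover have "(\<lambda>k. (\<kappa> k - \<beta> * (ym \<bullet> w k)) / \<alpha>) \<longlonglongrightarrow> (0 - \<beta> * 0) / \<alpha>"
    using \<alpha> by (intro tendsto_intros \<kappa>0 qw)
  ultimately have pw: "(\<lambda>k. yp \<bullet> w k) \<longlonglongrightarrow> 0"
    by simp

  \<comment> \<open>Neither \<mu> nor \<nu> equals 1, so M - I can be undone coordinatewise and the
    convergence of \<open>w\<close> passes to \<open>E\<close>.\<close>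
  have "yp \<bullet> w k = (\<mu> - 1) * (yp \<bullet> E k)" and "ym \<bullet> w k = (\<nu> - 1) * (ym \<bullet> E k)" for k
    unfolding w_def by (simp_all add: matrix_vector_mult_diff_rdistrib inner_diff_right yp ym algebra_simps)
  then have "(\<lambda>k. yp \<bullet> E k) = (\<lambda>k. (yp \<bullet> w k) / (\<mu> - 1))" "(\<lambda>k. ym \<bullet> E k) = (\<lambda>k. (ym \<bullet> w k) / (\<nu> - 1))"
    using \<mu> \<nu> by simp_all
  then have "(\<lambda>k. yp \<bullet> E k) \<longlonglongrightarrow> 0" "(\<lambda>k. ym \<bullet> E k) \<longlonglongrightarrow> 0"
    using tendsto_divide_zero[OF pw] tendsto_divide_zero[OF qw] by simp_all
  then have "((\<lambda>t. yp \<bullet> ec t) \<longlongrightarrow> 0) at_top" "((\<lambda>t. ym \<bullet> ec t) \<longlongrightarrow> 0) at_top"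
    unfolding E_def yp_def ym_def
    by (auto intro: jump_flow_left_eigenvector_tendsto_zero[OF Ts flow] A_lam_left_eigenvector)
  then have "((\<lambda>t. (yp \<bullet> ec t / (2 * lam)) *\<^sub>R vp + (ym \<bullet> ec t / (2 * lam)) *\<^sub>R vm)
      \<longlongrightarrow> (0 / (2 * lam)) *\<^sub>R vp + (0 / (2 * lam)) *\<^sub>R vm) at_top"
    using lam by (intro tendsto_intros) auto
  then have ec0: "(ec \<longlongrightarrow> 0) at_top"
    unfolding expansion[symmetric] by simp
  moreover have "((\<lambda>t. dist (xc t) (xd t)) \<longlongrightarrow> 0) at_top"
    using tendsto_norm[OF ec0] by (simp add: assms(12) dist_norm norm_minus_commute)
  ultimately show ?thesis by blast
qed

end
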